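(* Let $f \in \mathbb{C}[x]$ be a polynomial with $\deg f \geq 1$. Then for all solutions $(n,m,p,q)$ in integers $n,m \geq 2$ and polynomials $p,q \in \mathbb{C}[x]$ with $\deg p, \deg q \geq 1$ of the equation $$p^n - q^m = f$$ we have $$\max(n,m,\deg p,\deg q) \leq 4 + 12 \deg f + 8 (\deg f)^2.$$ In particular, for the given $f$, the vector $(n,m,\deg p,\deg q)$, as $(n,m,p,q)$ ranges over all such solutions, can take only finitely many different values.
   Context: Here $\mathbb{C}[x]$ is the ring of polynomials in one variable over the complex numbers, $\deg$ denotes the degree in $x$, and $p^n$, $q^m$ denote the ordinary (multiplicative) powers of the polynomials. *)

theory Defs
  imports Complex_Main "HOL-Computational_Algebra.Computational_Algebra"
begin

end

theory Submission
  imports Defs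
begin

text \<open>
  The proof is a Mason--Stothers argument carried out on the equation itself, so that common
  factors of \<open>p\<close> and \<open>q\<close> do no harm. Put \<open>F = degree f\<close>, \<open>a = degree p\<close>, \<open>b = degree q\<close>. If the leading terms of
  \<open>p ^ n\<close> and \<open>q ^ m\<close> have different degrees, they cannot cancel and \<open>n * a\<close>, \<open>m * b\<close> are at most
  \<open>F\<close>. Otherwise \<open>n * a = m * b\<close>; call this number \<open>D\<close>.

  Consider \<open>f' p - n f p'\<close>, which is \<open>p ^ (n + 1)\<close> times the derivative of \<open>f / p ^ n\<close>. Since
  \<open>f / p ^ n = 1 - q ^ m / p ^ n\<close>, this polynomial is divisible by \<open>q ^ (m - 1)\<close>, while its degree
  is less than \<open>F + a\<close>. So either it vanishes, and comparing leading coefficients gives \<open>F = n * a\<close>,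
  or \<open>(m - 1) * b < F + a\<close> (lemma \<open>power_difference_dichotomy\<close>). In the second case
  \<open>D < F + a + b = F + D / n + D / m\<close>, that is \<open>D * (1 - 1 / n - 1 / m) < F\<close>. For
  \<open>(n, m) \<noteq> (2, 2)\<close> the factor is at least \<open>1 / 6\<close>, and so \<open>D < 6 * F\<close>. For \<open>n = m = 2\<close> the factor
  is zero, but then \<open>f = (p - q) (p + q)\<close> bounds the degrees of both factors, hence of \<open>p\<close> and \<open>q\<close>.

  In every case \<open>n * a\<close> and \<open>m * b\<close> are at most \<open>6 * F\<close> (lemma \<open>degree_powers_le\<close>), which is
  stronger than the bound claimed; finiteness follows because the four numbers lie in a bounded box.
\<close>

lemma coeff_mult_at_degree_bounds:
  fixes g h :: "'a :: comm_semiring_0 poly"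
  assumes "degree g \<le> k" "degree h \<le> l"
  shows "coeff (g * h) (k + l) = coeff g k * coeff h l"
proof -
  have "coeff g i * coeff h (k + l - i) = 0" if "i \<noteq> k" for i
    using that assms by (cases "i < k") (auto simp: coeff_eq_0)
  then have "(\<Sum>i\<le>k + l. coeff g i * coeff h (k + l - i))
      = (\<Sum>i\<in>{k}. coeff g i * coeff h (k + l - i))"
    by (intro sum.mono_neutral_right) auto
  then show ?thesis by (simp add: coeff_mult)
qed

text \<open>The coefficient of \<open>x ^ (degree f + degree p - 1)\<close> on the left is \<open>degree f\<close> times the product
  of the leading coefficients, on the right it is \<open>n * degree p\<close> times the same product.\<close>

lemma degree_eq_if_log_derivatives_proportional:
  fixes f p :: "'a :: field_char_0 poly"
  assumes eq: "pderiv f * p = of_nat n * f * pderiv p"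
    and "f \<noteq> 0" "p \<noteq> 0"
  shows "degree f = n * degree p"
proof -
  \<comment> \<open>Multiplying by \<open>x\<close> avoids truncated degrees: \<open>x g'\<close> has leading term \<open>degree g\<close> times
    that of \<open>g\<close>, also when \<open>g\<close> is constant.\<close>
  have euler: "coeff (pCons 0 (pderiv g)) (degree g) = of_nat (degree g) * lead_coeff g"
    "degree (pCons 0 (pderiv g)) \<le> degree g" for g :: "'a poly"
    by (cases "degree g"; force simp: coeff_pCons coeff_pderiv degree_pderiv pderiv_eq_0_iff
        split: nat.splits)+
  have eq': "pCons 0 (pderiv f) * p = smult (of_nat n) (f * pCons 0 (pderiv p))"
    using eq by (simp add: of_nat_poly mult_ac)
  have "of_nat (degree f) * (lead_coeff f * lead_coeff p)
      = coeff (pCons 0 (pderiv f) * p) (degree f + degree p)"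
    by (simp only: coeff_mult_at_degree_bounds[OF euler(2) order_refl] euler(1) mult.assoc)
  also have "\<dots> = of_nat (n * degree p) * (lead_coeff f * lead_coeff p)"
    unfolding eq'
    by (simp only: coeff_smult coeff_mult_at_degree_bounds[OF order_refl euler(2)] euler(1)
        of_nat_mult mult_ac)
  finally have "(of_nat (degree f) :: 'a) = of_nat (n * degree p)"
    using assms(2,3) by simp
  then show ?thesis by (simp only: of_nat_eq_iff)
qed

lemma degree_wronskian_less:
  fixes f p :: "'a :: field_char_0 poly"
  assumes "degree f \<ge> 1" "degree p \<ge> 1"
  shows "degree (pderiv f * p - of_nat n * f * pderiv p) < degree f + degree p"
proof (rule degree_diff_less)
  show "degree (pderiv f * p) < degree f + degree p"
    using assms degree_mult_le[of "pderiv f" p] by (simp add: degree_pderiv)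
  have "degree (of_nat n * f * pderiv p) \<le> degree f + degree (pderiv p)"
    using degree_mult_le[of f "pderiv p"] degree_smult_le[of "of_nat n" "f * pderiv p"]
    by (simp add: of_nat_poly)
  then show "degree (of_nat n * f * pderiv p) < degree f + degree p"
    using assms by (simp add: degree_pderiv)
qed

text \<open>The powers \<open>p ^ n\<close> cancel in \<open>f' p - n f p'\<close>, which leaves only terms coming from \<open>q ^ m\<close> and
  its derivative, all divisible by \<open>q ^ (m - 1)\<close>.\<close>

lemma wronskian_power_difference:
  fixes p q :: "'a :: field_char_0 poly"
  assumes "p ^ n - q ^ m = f" "n \<ge> 1" "m \<ge> 1"
  shows "pderiv f * p - of_nat n * f * pderiv p
       = q ^ (m - 1) * (of_nat n * pderiv p * q - of_nat m * p * pderiv q)"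
proof -
  obtain k l where kl: "n = Suc k" "m = Suc l"
    using assms by (metis Suc_le_D One_nat_def)
  have "pderiv f = of_nat n * p ^ k * pderiv p - of_nat m * q ^ l * pderiv q"
    unfolding assms(1)[symmetric] kl
    by (simp only: pderiv_diff pderiv_power_Suc of_nat_poly) simp
  then have "pderiv f * p - of_nat n * f * pderiv p
      = (of_nat n * p ^ k * pderiv p - of_nat m * q ^ l * pderiv q) * p
        - of_nat n * (p ^ n - q ^ m) * pderiv p"
    using assms(1) by simp
  then show ?thesis
    unfolding kl by (simp add: algebra_simps)
qed

lemma power_difference_dichotomy:
  fixes p q :: "'a :: field_char_0 poly"
  assumes "p ^ n - q ^ m = f" "n \<ge> 1" "m \<ge> 1"
    and "degree f \<ge> 1" "degree p \<ge> 1"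
  shows "degree f = n * degree p \<or> (m - 1) * degree q < degree f + degree p"
proof (cases "pderiv f * p - of_nat n * f * pderiv p = 0")
  case True
  then show ?thesis
    using degree_eq_if_log_derivatives_proportional[of f p n] assms(4,5) by force
next
  case False
  define w where "w = of_nat n * pderiv p * q - of_nat m * p * pderiv q"
  have eq: "pderiv f * p - of_nat n * f * pderiv p = q ^ (m - 1) * w"
    using wronskian_power_difference[OF assms(1-3)] by (simp add: w_def)
  with False have "q ^ (m - 1) \<noteq> 0" "w \<noteq> 0" by auto
  then have "(m - 1) * degree q \<le> degree (q ^ (m - 1) * w)"
    by (cases "q = 0") (simp_all add: degree_mult_eq degree_power_eq)
  also have "\<dots> < degree f + degree p"
    using degree_wronskian_less[OF assms(4,5), of n] eq by simp
  finally show ?thesis by simp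
qed

text \<open>This covers the one pair of exponents for which \<open>1 / n + 1 / m = 1\<close>, where the derivative
  argument gives no information. Both factors of \<open>f\<close> have degree at most \<open>degree f\<close>, and \<open>p\<close> is half
  their sum.\<close>

lemma degree_le_square_difference:
  fixes p q :: "'a :: field_char_0 poly"
  assumes "p\<^sup>2 - q\<^sup>2 = f" "f \<noteq> 0"
  shows "degree p \<le> degree f"
proof -
  have f: "f = (p - q) * (p + q)"
    using assms(1) by (simp add: power2_eq_square algebra_simps)
  with assms(2) have "degree f = degree (p - q) + degree (p + q)"
    by (auto simp: degree_mult_eq)
  then have "degree ((p - q) + (p + q)) \<le> degree f"
    by (metis degree_add_le le_add1 le_add2)
  moreover have "(p - q) + (p + q) = smult 2 p"
    by (simp add: smult_add_left[of 1 1 p, simplified])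
  ultimately show ?thesis by simp
qed

text \<open>The constant 6 comes from the exponents \<open>{n, m} = {2, 3}\<close>: there \<open>1 - 1 / n - 1 / m\<close> takes its
  smallest positive value, \<open>1 / 6\<close>.\<close>

lemma degree_powers_le:
  fixes p q :: "'a :: field_char_0 poly"
  assumes eq: "p ^ n - q ^ m = f" and "n \<ge> 2" "m \<ge> 2"
    and deg: "degree f \<ge> 1" "degree p \<ge> 1" "degree q \<ge> 1"
  shows "n * degree p \<le> 6 * degree f \<and> m * degree q \<le> 6 * degree f"
proof -
  have degs: "degree (p ^ n) = n * degree p" "degree (q ^ m) = m * degree q"
    using deg by (auto intro!: degree_power_eq)
  have eq': "q ^ m - p ^ n = - f" using eq by (simp add: algebra_simps)
  consider "n * degree p < m * degree q" | "m * degree q < n * degree p"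
    | "n * degree p = m * degree q" by linarith
  then show ?thesis
  proof cases
    case 1
    then have "degree f = m * degree q"
      using degree_add_eq_right[of "- (p ^ n)" "q ^ m"] degs eq'
      by (metis add.commute degree_minus uminus_add_conv_diff)
    with 1 show ?thesis by linarith
  next
    case 2
    then have "degree f = n * degree p"
      using degree_add_eq_right[of "- (q ^ m)" "p ^ n"] degs eq
      by (metis add.commute degree_minus uminus_add_conv_diff)
    with 2 show ?thesis by linarith
  next
    case 3
    consider "n = 2" "m = 2" | "degree f = n * degree p"
      | "n \<noteq> 2 \<or> m \<noteq> 2" "(m - 1) * degree q < degree f + degree p"
      using power_difference_dichotomy[OF eq] assms by fastforce
    then show ?thesis
    proof cases
      case 1
      then have "degree p \<le> degree f"
        using degree_le_square_difference[of p q f] eq deg by fastforce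
      with 1 3 show ?thesis by simp
    next
      case prems: 3
      have less: "m * degree q < degree f + degree p + degree q"
        using prems(2) \<open>m \<ge> 2\<close> by (simp add: diff_mult_distrib)
      have mono: "k * degree p \<le> n * degree p \<and> l * degree q \<le> m * degree q"
        if "k \<le> n" "l \<le> m" for k l using that by simp
      have "(2 \<le> n \<and> 3 \<le> m) \<or> (3 \<le> n \<and> 2 \<le> m)"
        using prems(1) assms(2,3) by linarith
      \<comment> \<open>One of the two degrees is at most half, the other at most a third of the common value
        \<open>n * degree p = m * degree q\<close>, and \<open>1 / 2 + 1 / 3 = 5 / 6\<close>.\<close>
      then have "6 * degree p + 6 * degree q \<le> 5 * (m * degree q)"
        using mono[of 2 3] mono[of 3 2] 3 by linarith
      with less 3 show ?thesis by linarith
    qed (use 3 in auto)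
  qed
qed

theorem theorem1:
  fixes f :: "complex poly"
  assumes "degree f \<ge> 1"
  shows "(\<forall>(n::nat) (m::nat) (p :: complex poly) (q :: complex poly).
            n \<ge> 2 \<longrightarrow> m \<ge> 2 \<longrightarrow> degree p \<ge> 1 \<longrightarrow> degree q \<ge> 1 \<longrightarrow> p ^ n - q ^ m = f \<longrightarrow>
              Max {n, m, degree p, degree q} \<le> 4 + 12 * degree f + 8 * (degree f)\<^sup>2)
       \<and> finite {(n, m, degree p, degree q) | (n::nat) (m::nat) (p :: complex poly) (q :: complex poly).
            n \<ge> 2 \<and> m \<ge> 2 \<and> degree p \<ge> 1 \<and> degree q \<ge> 1 \<and> p ^ n - q ^ m = f}"
proof -
  have bound: "n \<le> 6 * degree f \<and> m \<le> 6 * degree f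
      \<and> degree p \<le> 6 * degree f \<and> degree q \<le> 6 * degree f"
    if "n \<ge> 2" "m \<ge> 2" "degree p \<ge> 1" "degree q \<ge> 1" "p ^ n - q ^ m = f"
    for n m and p q :: "complex poly"
  proof -
    have le: "k \<le> k * l" "l \<le> k * l" if "k \<ge> 1" "l \<ge> 1" for k l :: nat
      using that by auto
    show ?thesis
      using degree_powers_le[OF that(5,1,2) assms that(3,4)]
        le[of n "degree p"] le[of m "degree q"] that by linarith
  qed
  let ?B = "{..6 * degree f}"
  have "finite {(n, m, degree p, degree q) | n m (p :: complex poly) (q :: complex poly).
      n \<ge> 2 \<and> m \<ge> 2 \<and> degree p \<ge> 1 \<and> degree q \<ge> 1 \<and> p ^ n - q ^ m = f}"
    by (rule finite_subset[of _ "?B \<times> ?B \<times> ?B \<times> ?B"]) (use bound in auto)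
  moreover have "Max {n, m, degree p, degree q} \<le> 4 + 12 * degree f + 8 * (degree f)\<^sup>2"
    if "n \<ge> 2" "m \<ge> 2" "degree p \<ge> 1" "degree q \<ge> 1" "p ^ n - q ^ m = f"
    for n m and p q :: "complex poly"
    using bound[OF that] by simp
  ultimately show ?thesis by blast
qed

end
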